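(* Let $\{X_t\}_{t\ge 0}$ be a semi-Lévy process on $\mathbb{R}^d$ with period $p>0$, and let $\{Y_t\}_{t\ge 0}$ be a Lévy process on $\mathbb{R}^d$ such that $Y_1$ and $X_p$ have the same distribution (such a Lévy process exists because $X_p$ is infinitely divisible). Then $\{X_t\}_{t\ge 0}$ is recurrent if and only if $\{Y_t\}_{t\ge 0}$ is recurrent.
   Context: An additive process on $\mathbb{R}^d$ is an $\mathbb{R}^d$-valued stochastic process $\{X_t\}_{t\ge 0}$ with $X_0=0$ a.s. that is stochastically continuous, has independent increments, and has sample paths that are right-continuous in $t\ge 0$ with left limits in $t>0$. A Lévy process is an additive process with stationary increments. A semi-Lévy process with period $p>0$ is an additive process such that $X_{t+p}-X_{s+p}$ and $X_t-X_s$ have the same distribution for all $s,t\ge 0$. An additive process $\{X_t\}_{t\ge0}$ is recurrent if $\liminf_{t\to\infty}|X_t-X_s|=0$ a.s. for every $s\ge 0$, where $|\cdot|$ is the Euclidean norm. *)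

theory Defs
  imports "HOL-Probability.Probability"
begin

(* Time is real-valued, but every condition constrains X t only for t \<ge> 0. The state space is an
   arbitrary Euclidean space, whose norm is the Euclidean one. *)

locale additive_process = prob_space M
  for M :: "'w measure" and X :: "real \<Rightarrow> 'w \<Rightarrow> 'a::euclidean_space" +
  assumes random_variable_process: "\<And>t. 0 \<le> t \<Longrightarrow> random_variable borel (X t)"
    and start_at_zero: "AE \<omega> in M. X 0 \<omega> = 0"
    and stochastically_continuous:
      "\<And>t \<epsilon>. 0 \<le> t \<Longrightarrow> 0 < \<epsilon> \<Longrightarrow>
         ((\<lambda>s. prob {\<omega> \<in> space M. norm (X s \<omega> - X t \<omega>) > \<epsilon>}) \<longlongrightarrow> 0) (at t within {0..})"
    and independent_increments:
      "\<And>(n::nat) (t::nat \<Rightarrow> real). 0 \<le> t 0 \<Longrightarrow> (\<And>i. i < n \<Longrightarrow> t i < t (Suc i)) \<Longrightarrow>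
         indep_vars (\<lambda>_. borel) (\<lambda>i \<omega>. X (t (Suc i)) \<omega> - X (t i) \<omega>) {..<n}"
    and right_continuous_paths:
      "\<And>\<omega> t. \<omega> \<in> space M \<Longrightarrow> 0 \<le> t \<Longrightarrow> continuous (at_right t) (\<lambda>s. X s \<omega>)"
    and left_limits_paths:
      "\<And>\<omega> t. \<omega> \<in> space M \<Longrightarrow> 0 < t \<Longrightarrow> \<exists>l. ((\<lambda>s. X s \<omega>) \<longlongrightarrow> l) (at_left t)"

locale levy_process = additive_process M X
  for M :: "'w measure" and X :: "real \<Rightarrow> 'w \<Rightarrow> 'a::euclidean_space" +
  assumes stationary_increments:
    "\<And>s t h. 0 \<le> s \<Longrightarrow> 0 \<le> t \<Longrightarrow> 0 \<le> h \<Longrightarrow>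
       distr M borel (\<lambda>\<omega>. X (t + h) \<omega> - X (s + h) \<omega>) = distr M borel (\<lambda>\<omega>. X t \<omega> - X s \<omega>)"

locale semi_levy_process = additive_process M X
  for M :: "'w measure" and X :: "real \<Rightarrow> 'w \<Rightarrow> 'a::euclidean_space" and p :: real +
  assumes period_pos: "0 < p"
    and periodic_increments:
    "\<And>s t. 0 \<le> s \<Longrightarrow> 0 \<le> t \<Longrightarrow>
       distr M borel (\<lambda>\<omega>. X (t + p) \<omega> - X (s + p) \<omega>) = distr M borel (\<lambda>\<omega>. X t \<omega> - X s \<omega>)"

(* The coercion to ereal only serves to form the lower limit in a complete lattice. *)
definition recurrent :: "'w measure \<Rightarrow> (real \<Rightarrow> 'w \<Rightarrow> 'a::euclidean_space) \<Rightarrow> bool" where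
  "recurrent M X \<longleftrightarrow>
     (\<forall>s\<ge>0. AE \<omega> in M. Liminf at_top (\<lambda>t. ereal (norm (X t \<omega> - X s \<omega>))) = 0)"

end

theory Submission
  imports Defs
begin

text \<open>
The process enters only through one law. Seen at the times \<open>s + n * p\<close>, a semi-Levy process of
period \<open>p\<close> is a random walk started at \<open>X s\<close>, and its step law is that of \<open>X p\<close> for every
\<open>s \<ge> 0\<close>: for \<open>0 \<le> s \<le> p\<close> the increment from \<open>s\<close> to \<open>s + p\<close> is the increment from \<open>s\<close> to \<open>p\<close>
plus an independent copy of the increment from \<open>0\<close> to \<open>s\<close>, and convolution is commutative. A Levy
process is semi-Levy with period \<open>1\<close>. Hence it suffices to characterise recurrence of a semi-Levy
process by a property of the law of \<open>X p\<close> (theorem \<open>recurrent_iff_persistent\<close>). The property,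
\<open>persistent \<mu>\<close>, is the classical one: the random walk \<open>S\<close> with step law \<open>\<mu>\<close> has an infinite expected
number of visits to every ball around the origin.

If the walk is persistent, then it comes arbitrarily close to the origin infinitely often, almost
surely (\<open>frequently_near_zero\<close>); applied to the walk along \<open>s + n * p\<close> this gives
\<open>liminf |X t - X s| = 0\<close> for each \<open>s\<close>.

If the walk is not persistent, then the expected number of visits to \<^emph>\<open>every\<close> ball is finite
(\<open>summable_visits_any_ball\<close>). The difficulty is that the process could be near the origin between
the times \<open>n * p\<close> without the walk noticing. Stochastic continuity and compactness of \<open>{0..p}\<close> give
a radius \<open>K\<close> such that, from any time in a period, the process moves by at most \<open>K\<close> until the end of
that period with probability at least \<open>1/2\<close>. Since the movement after the first time at which
\<open>|X t - X 0| < 1\<close> is independent of the past, a visit to the unit ball during the \<open>n\<close>-th period is at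
most twice as likely as the event \<open>|S (n + 1)| < 1 + K\<close> (\<open>prob_visit_ball_le\<close>). These probabilities
are summable, so by Borel-Cantelli the process eventually stays outside the unit ball. The argument
is carried out on dyadic time grids, where first entry times are elementary; right-continuity of
the paths shows that the grids miss no visit.
\<close>

section \<open>Independence, convolution and tails\<close>

lemma (in prob_space) indep_vars_UNIV_if_initial:
  fixes \<xi> :: "nat \<Rightarrow> 'a \<Rightarrow> 'b"
  assumes "\<And>n. indep_vars N \<xi> {..<n}"
  shows "indep_vars N \<xi> UNIV"
  unfolding indep_vars_def
proof (intro conjI ballI)
  fix i :: nat
  show "random_variable (N i) (\<xi> i)"
    using assms[of "Suc i"] by (auto simp: indep_vars_def)
next
  show "indep_sets (\<lambda>i. sigma_sets (space M) {\<xi> i -` A \<inter> space M |A. A \<in> sets (N i)}) UNIV"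
  proof (subst indep_sets_finite_index_sets, intro allI impI)
    fix J :: "nat set" assume "finite J"
    then obtain n where "J \<subseteq> {..<n}"
      using finite_nat_iff_bounded by blast
    with assms[of n] show "indep_sets (\<lambda>i. sigma_sets (space M) {\<xi> i -` A \<inter> space M |A. A \<in> sets (N i)}) J"
      by (auto simp: indep_vars_def intro: indep_sets_mono_index)
  qed
qed

text \<open>The law of a sum of two independent vectors is the convolution of their laws, and convolution is
commutative; so two such sums have the same law as soon as their summands agree crosswise.\<close>

lemma (in prob_space) distr_add_cong_swap:
  fixes U V U' V' :: "'a \<Rightarrow> 'b::euclidean_space"
  assumes UV: "indep_var borel U borel V" and UV': "indep_var borel U' borel V'"
    and U: "distr M borel U = distr M borel V'" and V: "distr M borel V = distr M borel U'"
  shows "distr M borel (\<lambda>\<omega>. U \<omega> + V \<omega>) = distr M borel (\<lambda>\<omega>. U' \<omega> + V' \<omega>)"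
proof -
  note [measurable] = indep_var_rv1[OF UV] indep_var_rv2[OF UV]
    indep_var_rv1[OF UV'] indep_var_rv2[OF UV']
  interpret A: prob_space "distr M borel U" by (rule prob_space_distr) simp
  interpret B: prob_space "distr M borel V" by (rule prob_space_distr) simp
  interpret pair_sigma_finite "distr M borel U" "distr M borel V" ..
  have "distr M borel (\<lambda>\<omega>. U \<omega> + V \<omega>)
      = distr (distr M (borel \<Otimes>\<^sub>M borel) (\<lambda>\<omega>. (U \<omega>, V \<omega>))) borel (\<lambda>(x, y). x + y)"
    by (subst distr_distr) (auto simp: comp_def)
  also have "\<dots> = distr (distr M borel U \<Otimes>\<^sub>M distr M borel V) borel (\<lambda>(x, y). x + y)"
    using UV by (simp add: indep_var_distribution_eq)
  also have "\<dots> = distr (distr (distr M borel V \<Otimes>\<^sub>M distr M borel U)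
      (distr M borel U \<Otimes>\<^sub>M distr M borel V) (\<lambda>(x, y). (y, x))) borel (\<lambda>(x, y). x + y)"
    by (subst distr_pair_swap) simp
  also have "\<dots> = distr (distr M borel V \<Otimes>\<^sub>M distr M borel U) borel (\<lambda>(x, y). y + x)"
    by (subst distr_distr) (auto simp: comp_def split_beta')
  also have "\<dots> = distr (distr M borel U' \<Otimes>\<^sub>M distr M borel V') borel (\<lambda>(x, y). x + y)"
    using U V by (simp add: add.commute)
  also have "\<dots> = distr (distr M (borel \<Otimes>\<^sub>M borel) (\<lambda>\<omega>. (U' \<omega>, V' \<omega>))) borel (\<lambda>(x, y). x + y)"
    using UV' by (simp add: indep_var_distribution_eq)
  also have "\<dots> = distr M borel (\<lambda>\<omega>. U' \<omega> + V' \<omega>)"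
    by (subst distr_distr) (auto simp: comp_def)
  finally show ?thesis .
qed

lemma (in prob_space) norm_tail_small:
  fixes Z :: "'a \<Rightarrow> 'b::euclidean_space" and \<epsilon> :: real
  assumes [measurable]: "Z \<in> borel_measurable M" and "0 < \<epsilon>"
  shows "\<exists>K. prob {\<omega> \<in> space M. norm (Z \<omega>) > K} < \<epsilon>"
proof -
  let ?A = "\<lambda>n::nat. {\<omega> \<in> space M. norm (Z \<omega>) > real n}"
  have "(\<lambda>n. prob (?A n)) \<longlonglongrightarrow> prob (\<Inter>n. ?A n)"
    by (intro finite_Lim_measure_decseq) (auto simp: decseq_def)
  moreover have "(\<Inter>n. ?A n) = {}"
  proof -
    have "\<exists>n::nat. norm (Z \<omega>) \<le> n" for \<omega> by (rule real_arch_simple)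
    then show ?thesis by (auto simp: not_less) (meson not_less)
  qed
  ultimately have "(\<lambda>n. prob (?A n)) \<longlonglongrightarrow> 0" by simp
  from order_tendstoD(2)[OF this \<open>0 < \<epsilon>\<close>] show ?thesis
    by (auto simp: eventually_sequentially)
qed

section \<open>Sums of independent steps\<close>

text \<open>The steps need not be identically distributed: on a time grid finer than the period, the
increments of a semi-Levy process are independent but have different laws.\<close>

locale independent_steps = prob_space M
  for M :: "'w measure" and \<xi> :: "nat \<Rightarrow> 'w \<Rightarrow> 'a::euclidean_space" +
  assumes indep_steps: "indep_vars (\<lambda>_. borel) \<xi> UNIV"
begin

definition S :: "nat \<Rightarrow> 'w \<Rightarrow> 'a" where
  "S n \<omega> = (\<Sum>i<n. \<xi> i \<omega>)"

lemma measurable_step [measurable]: "\<xi> i \<in> borel_measurable M"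
  using indep_steps by (auto simp: indep_vars_def)

lemma measurable_S [measurable]: "S n \<in> borel_measurable M"
  unfolding S_def by measurable

lemma S_diff: "j \<le> n \<Longrightarrow> S n \<omega> - S j \<omega> = (\<Sum>i\<in>{j..<n}. \<xi> i \<omega>)"
  unfolding S_def using sum_diff_nat_ivl[of 0 j n "\<lambda>i. \<xi> i \<omega>"] by (simp add: lessThan_atLeast0)

lemma S_diff_shift:
  assumes "m \<le> n"
  shows "S n \<omega> - S m \<omega> = (\<Sum>i<n - m. \<xi> (m + i) \<omega>)"
  using assms sum.shift_bounds_nat_ivl[of "\<lambda>i. \<xi> i \<omega>" 0 m "n - m"]
  by (simp add: S_diff lessThan_atLeast0 add.commute)

text \<open>The future is taken to be infinite, so that an event such as never returning to a ball after
time \<open>j\<close> is covered.\<close>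

lemma prob_past_and_future:
  assumes P [measurable]: "Measurable.pred (PiM {..<j} (\<lambda>_. borel)) P"
    and Q [measurable]: "Measurable.pred (PiM {j..} (\<lambda>_. borel)) Q"
  shows "prob {\<omega> \<in> space M. P (\<lambda>i\<in>{..<j}. \<xi> i \<omega>) \<and> Q (\<lambda>i\<in>{j..}. \<xi> i \<omega>)}
    = prob {\<omega> \<in> space M. P (\<lambda>i\<in>{..<j}. \<xi> i \<omega>)} * prob {\<omega> \<in> space M. Q (\<lambda>i\<in>{j..}. \<xi> i \<omega>)}"
proof -
  have "indep_var (PiM {..<j} (\<lambda>_. borel)) (\<lambda>\<omega>. \<lambda>i\<in>{..<j}. \<xi> i \<omega>)
      (PiM {j..} (\<lambda>_. borel)) (\<lambda>\<omega>. \<lambda>i\<in>{j..}. \<xi> i \<omega>)"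
    by (rule indep_var_restrict[OF indep_steps]) auto
  from indep_var_compose[OF this P Q]
  have "indep_var (count_space UNIV) (P \<circ> (\<lambda>\<omega>. \<lambda>i\<in>{..<j}. \<xi> i \<omega>))
      (count_space UNIV) (Q \<circ> (\<lambda>\<omega>. \<lambda>i\<in>{j..}. \<xi> i \<omega>))" .
  from indep_varD[OF this, of "{True}" "{True}"] show ?thesis
    by (simp add: vimage_def Int_def conj_commute)
qed

text \<open>For \<open>j \<ge> k\<close> the event says that \<open>j\<close> is the first time from \<open>k\<close> onwards at which the walk is in
\<open>A\<close>. Visits before time \<open>k\<close> do not count, so that a single period can be watched.\<close>

definition first_entry :: "'a set \<Rightarrow> nat \<Rightarrow> nat \<Rightarrow> 'w set" where
  "first_entry A k j = {\<omega> \<in> space M. S j \<omega> \<in> A \<and> (\<forall>i\<in>{k..<j}. S i \<omega> \<notin> A)}"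

lemma sets_first_entry [measurable]:
  assumes [measurable]: "A \<in> sets borel"
  shows "first_entry A k j \<in> sets M"
  unfolding first_entry_def by measurable

lemma first_entry_disjoint: "disjoint_family_on (first_entry A k) {k..}"
proof -
  have "first_entry A k i \<inter> first_entry A k j = {}" if "k \<le> i" "i < j" for i j
    using that by (auto simp: first_entry_def)
  then show ?thesis
    unfolding disjoint_family_on_def by (metis atLeast_iff inf_commute nat_neq_iff)
qed

lemma visit_eq_UN_first_entry:
  "{\<omega> \<in> space M. \<exists>j\<in>{k..m}. S j \<omega> \<in> A} = (\<Union>j\<in>{k..m}. first_entry A k j)"
proof (intro equalityI subsetI)
  fix \<omega> assume "\<omega> \<in> {\<omega> \<in> space M. \<exists>j\<in>{k..m}. S j \<omega> \<in> A}"
  then have \<omega>: "\<omega> \<in> space M" and ex: "\<exists>j. k \<le> j \<and> j \<le> m \<and> S j \<omega> \<in> A"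
    by auto
  define j where "j = (LEAST j. k \<le> j \<and> j \<le> m \<and> S j \<omega> \<in> A)"
  have j: "k \<le> j \<and> j \<le> m \<and> S j \<omega> \<in> A"
    unfolding j_def using ex by (rule LeastI_ex)
  moreover have "S i \<omega> \<notin> A" if "k \<le> i" "i < j" for i
    using not_less_Least[of i "\<lambda>j. k \<le> j \<and> j \<le> m \<and> S j \<omega> \<in> A"] that j
    unfolding j_def[symmetric] by auto
  ultimately show "\<omega> \<in> (\<Union>j\<in>{k..m}. first_entry A k j)"
    using \<omega> by (auto simp: first_entry_def)
qed (auto simp: first_entry_def)

text \<open>The Markov property at the first entry time: whether \<open>j\<close> is that time is decided by the steps before
\<open>j\<close>, which are independent of the later ones.\<close>

lemma prob_first_entry_and_increment:
  assumes [measurable]: "A \<in> sets borel" "C \<in> sets borel" and "j \<le> n"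
  shows "prob (first_entry A k j \<inter> {\<omega> \<in> space M. S n \<omega> - S j \<omega> \<in> C})
    = prob (first_entry A k j) * prob {\<omega> \<in> space M. S n \<omega> - S j \<omega> \<in> C}"
proof -
  define P where "P x \<longleftrightarrow> (\<Sum>i<j. x i) \<in> A \<and> (\<forall>l\<in>{k..<j}. (\<Sum>i<l. x i) \<notin> A)" for x :: "nat \<Rightarrow> 'a"
  define Q where "Q x \<longleftrightarrow> (\<Sum>i\<in>{j..<n}. x i) \<in> C" for x :: "nat \<Rightarrow> 'a"
  have part: "(\<lambda>x. \<Sum>i<l. x i :: 'a) \<in> borel_measurable (PiM {..<j} (\<lambda>_. borel))" if "l \<le> j" for l
    using that by (intro borel_measurable_sum measurable_component_singleton) auto
  have [measurable]: "(\<lambda>x. \<Sum>i\<in>{j..<n}. x i :: 'a) \<in> borel_measurable (PiM {j..} (\<lambda>_. borel))"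
    by (intro borel_measurable_sum measurable_component_singleton) auto
  have "Measurable.pred (PiM {..<j} (\<lambda>_. borel)) P"
    unfolding P_def
    by (intro pred_intros_logic pred_intros_finite pred_sets1[OF _ part]) (auto simp: assms)
  moreover have "Measurable.pred (PiM {j..} (\<lambda>_. borel)) Q"
    unfolding Q_def by measurable
  moreover have "P (\<lambda>i\<in>{..<j}. \<xi> i \<omega>) \<longleftrightarrow> S j \<omega> \<in> A \<and> (\<forall>i\<in>{k..<j}. S i \<omega> \<notin> A)" for \<omega>
    unfolding P_def S_def by (intro conj_cong ball_cong refl arg_cong[where f="\<lambda>x. x \<in> A"] arg_cong[where f="\<lambda>x. x \<notin> A"] sum.cong) auto
  moreover have "Q (\<lambda>i\<in>{j..}. \<xi> i \<omega>) \<longleftrightarrow> S n \<omega> - S j \<omega> \<in> C" for \<omega>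
    unfolding Q_def S_diff[OF \<open>j \<le> n\<close>] by (intro arg_cong[where f="\<lambda>x. x \<in> C"] sum.cong) auto
  ultimately show ?thesis
    using prob_past_and_future[where j=j and P=P and Q=Q] by (simp add: first_entry_def Int_def conj_ac)
qed

text \<open>An inequality of Ottaviani type. If the walk enters the ball of radius \<open>a\<close>, then from its first
entry on it moves by at most \<open>K\<close> until time \<open>m\<close> with conditional probability at least \<open>c\<close>, and in
that case it ends in the ball of radius \<open>a + K\<close>.\<close>

lemma prob_visit_ball_le:
  assumes c: "\<And>j. k \<le> j \<Longrightarrow> j \<le> m \<Longrightarrow> c \<le> prob {\<omega> \<in> space M. norm (S m \<omega> - S j \<omega>) \<le> K}"
  shows "c * prob {\<omega> \<in> space M. \<exists>j\<in>{k..m}. norm (S j \<omega>) < a}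
    \<le> prob {\<omega> \<in> space M. norm (S m \<omega>) < a + K}"
proof -
  let ?T = "first_entry (ball 0 a) k"
  let ?D = "\<lambda>j. {\<omega> \<in> space M. S m \<omega> - S j \<omega> \<in> cball 0 K}"
  have disj: "disjoint_family_on ?T {k..m}"
    using first_entry_disjoint by (rule disjoint_family_on_mono[rotated]) auto
  have "{\<omega> \<in> space M. \<exists>j\<in>{k..m}. norm (S j \<omega>) < a} = (\<Union>j\<in>{k..m}. ?T j)"
    using visit_eq_UN_first_entry[of k m "ball 0 a"] by simp
  then have "c * prob {\<omega> \<in> space M. \<exists>j\<in>{k..m}. norm (S j \<omega>) < a} = (\<Sum>j\<in>{k..m}. c * prob (?T j))"
    using disj by (simp add: finite_measure_finite_Union sum_distrib_left image_subset_iff)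
  also have "\<dots> \<le> (\<Sum>j\<in>{k..m}. prob (?T j \<inter> ?D j))"
  proof (rule sum_mono)
    fix j assume j: "j \<in> {k..m}"
    then have "c \<le> prob (?D j)" using c[of j] by simp
    then have "c * prob (?T j) \<le> prob (?T j) * prob (?D j)"
      by (metis measure_nonneg mult.commute mult_left_mono)
    also have "\<dots> = prob (?T j \<inter> ?D j)"
      using j by (intro prob_first_entry_and_increment[symmetric]) auto
    finally show "c * prob (?T j) \<le> prob (?T j \<inter> ?D j)" .
  qed
  also have "\<dots> = prob (\<Union>j\<in>{k..m}. ?T j \<inter> ?D j)"
    using disj by (intro finite_measure_finite_Union[symmetric])
      (auto simp: disjoint_family_on_def)
  also have "\<dots> \<le> prob {\<omega> \<in> space M. norm (S m \<omega>) < a + K}"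
  proof (rule finite_measure_mono)
    have "norm (S m \<omega>) < a + K" if "norm (S j \<omega>) < a" "norm (S m \<omega> - S j \<omega>) \<le> K" for j \<omega>
      using norm_triangle_ineq[of "S m \<omega> - S j \<omega>" "S j \<omega>"] that by simp
    then show "(\<Union>j\<in>{k..m}. ?T j \<inter> ?D j) \<subseteq> {\<omega> \<in> space M. norm (S m \<omega>) < a + K}"
      by (auto simp: first_entry_def)
  qed measurable
  finally show ?thesis .
qed

end

section \<open>Random walks and persistence\<close>

locale random_walk = independent_steps M \<xi>
  for M :: "'w measure" and \<xi> :: "nat \<Rightarrow> 'w \<Rightarrow> 'a::euclidean_space" +
  fixes \<mu> :: "'a measure"
  assumes distr_step: "\<And>i. distr M borel (\<xi> i) = \<mu>"
begin

abbreviation "path_law \<equiv> PiM (UNIV :: nat set) (\<lambda>_. \<mu>)"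

lemma prob_space_\<mu>: "prob_space \<mu>"
  unfolding distr_step[of 0, symmetric] by (rule prob_space_distr) simp

lemma sets_\<mu> [measurable_cong]: "sets \<mu> = sets borel"
  unfolding distr_step[of 0, symmetric] by simp

text \<open>The future of the walk after time \<open>m\<close> is a fresh copy of the walk. In particular the law of
the walk is determined by the step law, which allows walks on different probability spaces to be
compared.\<close>

lemma path_law_shift:
  "distr M (PiM UNIV (\<lambda>_. borel)) (\<lambda>\<omega> i. \<xi> (m + i) \<omega>) = path_law"
proof -
  interpret \<mu>: prob_space \<mu> by (rule prob_space_\<mu>)
  have "distr M (PiM UNIV (\<lambda>_. borel)) (\<lambda>\<omega>. \<lambda>i\<in>UNIV. \<xi> i \<omega>) = path_law"
    using indep_vars_iff_distr_eq_PiM[where I=UNIV and M'="\<lambda>_. borel" and X=\<xi>] indep_steps by (simp add: distr_step)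
  then have law: "distr M (PiM UNIV (\<lambda>_. borel)) (\<lambda>\<omega> i. \<xi> i \<omega>) = path_law"
    by (simp add: restrict_def)
  have "distr M (PiM UNIV (\<lambda>_. borel)) (\<lambda>\<omega> i. \<xi> (m + i) \<omega>)
      = distr (distr M (PiM UNIV (\<lambda>_. borel)) (\<lambda>\<omega> i. \<xi> i \<omega>)) (PiM UNIV (\<lambda>_. borel)) (\<lambda>x i. x (m + i))"
    by (subst distr_distr) (auto simp: comp_def intro!: measurable_PiM_single')
  also have "\<dots> = distr path_law path_law (\<lambda>x i. x (m + i))"
    unfolding law by (intro distr_cong refl sets_PiM_cong) (simp_all add: sets_\<mu>)
  also have "\<dots> = path_law"
    using distr_PiM_reindex[of UNIV "\<lambda>_. \<mu>" "\<lambda>i. m + i" UNIV] \<mu>.prob_space_axioms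
    by (simp add: inj_on_def restrict_def)
  finally show ?thesis .
qed

lemma prob_shift:
  assumes [measurable]: "Measurable.pred (PiM UNIV (\<lambda>_. borel)) Q"
  shows "prob {\<omega> \<in> space M. Q (\<lambda>i. \<xi> (m + i) \<omega>)} = measure path_law {x \<in> space path_law. Q x}"
proof -
  have [measurable]: "(\<lambda>\<omega> i. \<xi> (m + i) \<omega>) \<in> measurable M (PiM UNIV (\<lambda>_. borel))"
    by (intro measurable_PiM_single') auto
  have "{x \<in> space (PiM UNIV (\<lambda>_. borel)). Q x} \<in> sets (PiM UNIV (\<lambda>_. borel))"
    by measurable
  then have [measurable]: "{x. Q x} \<in> sets (PiM UNIV (\<lambda>_. borel))"
    by (simp add: space_PiM)
  show ?thesis
    unfolding path_law_shift[of m, symmetric]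
    by (subst measure_distr) (auto simp: space_PiM vimage_def Int_def conj_commute)
qed

lemma prob_increment:
  assumes [measurable]: "A \<in> sets borel" and "m \<le> n"
  shows "prob {\<omega> \<in> space M. S n \<omega> - S m \<omega> \<in> A}
    = measure path_law {x \<in> space path_law. (\<Sum>i<n - m. x i) \<in> A}"
  using prob_shift[of "\<lambda>x. (\<Sum>i<n - m. x i) \<in> A" m] by (simp add: S_diff_shift[OF \<open>m \<le> n\<close>])

lemma prob_S:
  assumes "A \<in> sets borel"
  shows "prob {\<omega> \<in> space M. S n \<omega> \<in> A} = measure path_law {x \<in> space path_law. (\<Sum>i<n. x i) \<in> A}"
  using prob_increment[of A 0 n] assms by (simp add: S_def)

end

text \<open>
The measure of the set is the probability that a walk with step law \<open>\<mu>\<close> is within \<open>\<epsilon>\<close> of its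
starting point after \<open>n\<close> steps. It is written on the canonical path space so that the notion
depends on \<open>\<mu>\<close> only.
\<close>

definition persistent :: "'a::euclidean_space measure \<Rightarrow> bool" where
  "persistent \<mu> \<longleftrightarrow> (\<forall>\<epsilon>>0. \<not> summable (\<lambda>n.
     measure (PiM (UNIV :: nat set) (\<lambda>_. \<mu>))
       {x \<in> space (PiM UNIV (\<lambda>_. \<mu>)). norm (\<Sum>i<n. x i) < \<epsilon>}))"

context random_walk begin

lemma prob_norm_S:
  "prob {\<omega> \<in> space M. norm (S n \<omega>) < \<epsilon>}
    = measure path_law {x \<in> space path_law. norm (\<Sum>i<n. x i) < \<epsilon>}"
  using prob_S[of "ball 0 \<epsilon>" n] by simp

lemma prob_norm_increment:
  "m \<le> n \<Longrightarrow> prob {\<omega> \<in> space M. norm (S n \<omega> - S m \<omega>) < \<epsilon>} = prob {\<omega> \<in> space M. norm (S (n - m) \<omega>) < \<epsilon>}"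
  using prob_increment[of "ball 0 \<epsilon>" m n] by (simp add: prob_norm_S)

lemma persistent_iff:
  "persistent \<mu> \<longleftrightarrow> (\<forall>\<epsilon>>0. \<not> summable (\<lambda>n. prob {\<omega> \<in> space M. norm (S n \<omega>) < \<epsilon>}))"
  unfolding persistent_def prob_norm_S ..

text \<open>If the walk is within \<open>\<epsilon>\<close> of the origin at time \<open>m\<close> and from \<open>m + k\<close> on stays at distance at least
\<open>2 * \<epsilon>\<close> from its position at time \<open>m\<close>, then it also stays at distance at least \<open>\<epsilon>\<close> from the origin.
The two conditions are independent, and the second is as likely as for \<open>m = 0\<close>.\<close>

lemma prob_near_then_away:
  "prob {\<omega> \<in> space M. norm (S m \<omega>) < \<epsilon>} * prob {\<omega> \<in> space M. \<forall>n\<ge>k. 2 * \<epsilon> \<le> norm (S n \<omega>)}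
    \<le> prob {\<omega> \<in> space M. norm (S m \<omega>) < \<epsilon> \<and> (\<forall>n\<ge>m + k. \<epsilon> \<le> norm (S n \<omega>))}"
proof -
  define P where "P x \<longleftrightarrow> norm (\<Sum>i<m. x i) < \<epsilon>" for x :: "nat \<Rightarrow> 'a"
  define Q where "Q x \<longleftrightarrow> (\<forall>n\<in>{k..}. 2 * \<epsilon> \<le> norm (\<Sum>i<n. x (m + i)))" for x :: "nat \<Rightarrow> 'a"
  define R where "R x \<longleftrightarrow> (\<forall>n\<in>{k..}. 2 * \<epsilon> \<le> norm (\<Sum>i<n. x i))" for x :: "nat \<Rightarrow> 'a"
  have [measurable]: "Measurable.pred (PiM {..<m} (\<lambda>_. borel)) P"
    unfolding P_def by measurable
  have [measurable]: "(\<lambda>x. \<Sum>i<n. x (m + i) :: 'a) \<in> borel_measurable (PiM {m..} (\<lambda>_. borel))" for n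
    by (intro borel_measurable_sum measurable_component_singleton) auto
  have [measurable]: "Measurable.pred (PiM {m..} (\<lambda>_. borel)) Q"
    unfolding Q_def by measurable
  have [measurable]: "Measurable.pred (PiM UNIV (\<lambda>_. borel)) R"
    unfolding R_def by measurable
  have P: "P (\<lambda>i\<in>{..<m}. \<xi> i \<omega>) \<longleftrightarrow> norm (S m \<omega>) < \<epsilon>" for \<omega>
    unfolding P_def S_def by simp
  have Q: "Q (\<lambda>i\<in>{m..}. \<xi> i \<omega>) \<longleftrightarrow> R (\<lambda>i. \<xi> (m + i) \<omega>)" for \<omega>
    unfolding Q_def R_def by simp
  have R: "R (\<lambda>i. \<xi> i \<omega>) \<longleftrightarrow> (\<forall>n\<ge>k. 2 * \<epsilon> \<le> norm (S n \<omega>))" for \<omega>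
    unfolding R_def S_def by auto
  have "prob {\<omega> \<in> space M. norm (S m \<omega>) < \<epsilon>} * prob {\<omega> \<in> space M. \<forall>n\<ge>k. 2 * \<epsilon> \<le> norm (S n \<omega>)}
    = prob {\<omega> \<in> space M. norm (S m \<omega>) < \<epsilon>} * prob {\<omega> \<in> space M. R (\<lambda>i. \<xi> (m + i) \<omega>)}"
    using prob_shift[of R 0] prob_shift[of R m] by (simp add: R)
  also have "\<dots> = prob {\<omega> \<in> space M. norm (S m \<omega>) < \<epsilon> \<and> R (\<lambda>i. \<xi> (m + i) \<omega>)}"
    using prob_past_and_future[where j=m and P=P and Q=Q] by (simp add: P Q)
  also have "\<dots> \<le> prob {\<omega> \<in> space M. norm (S m \<omega>) < \<epsilon> \<and> (\<forall>n\<ge>m + k. \<epsilon> \<le> norm (S n \<omega>))}"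
  proof (rule finite_measure_mono, intro subsetI CollectI conjI; (elim CollectE conjE)?)
    fix \<omega> assume "norm (S m \<omega>) < \<epsilon>" and away: "R (\<lambda>i. \<xi> (m + i) \<omega>)"
    moreover have "2 * \<epsilon> \<le> norm (S n \<omega> - S m \<omega>)" if "n \<ge> m + k" for n
      using away that by (simp add: R_def S_diff_shift)
    moreover have "norm (S n \<omega> - S m \<omega>) \<le> norm (S n \<omega>) + norm (S m \<omega>)" for n
      by (rule norm_triangle_ineq4)
    ultimately show "\<forall>n\<ge>m + k. \<epsilon> \<le> norm (S n \<omega>)"
      by (smt (verit, best))
  qed measurable
  finally show ?thesis .
qed

text \<open>Any two times \<open>m\<close> at which the event occurs differ by less than \<open>k\<close>, since at the later one the
walk is within \<open>\<epsilon>\<close> of the origin. So at most \<open>k\<close> of the events can occur at once, and the sum is the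
expectation of their number.\<close>

lemma sum_prob_last_visits_le:
  "(\<Sum>m<L. prob {\<omega> \<in> space M. norm (S m \<omega>) < \<epsilon> \<and> (\<forall>n\<ge>m + k. \<epsilon> \<le> norm (S n \<omega>))}) \<le> k"
proof -
  let ?B = "\<lambda>m. {\<omega> \<in> space M. norm (S m \<omega>) < \<epsilon> \<and> (\<forall>n\<ge>m + k. \<epsilon> \<le> norm (S n \<omega>))}"
  have [measurable]: "?B m \<in> sets M" for m
    by measurable
  have card: "card {m. m < L \<and> \<omega> \<in> ?B m} \<le> k" for \<omega>
  proof (cases "{m. m < L \<and> \<omega> \<in> ?B m} = {}")
    case False
    let ?J = "{m. m < L \<and> \<omega> \<in> ?B m}"
    define m0 where "m0 = Min ?J"
    have m0: "m0 \<in> ?J"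
      unfolding m0_def by (rule Min_in[OF _ False]) simp
    have "m \<in> {m0..<m0 + k}" if m: "m \<in> ?J" for m
    proof -
      have "m0 \<le> m" unfolding m0_def by (rule Min_le[OF _ m]) simp
      moreover have "\<not> m0 + k \<le> m" using m m0 by (auto simp: not_le)
      ultimately show ?thesis by simp
    qed
    then have "?J \<subseteq> {m0..<m0 + k}" by blast
    from card_mono[OF _ this] show ?thesis by simp
  next
    case True
    show ?thesis unfolding True by simp
  qed
  have "(\<Sum>m<L. prob (?B m)) = (\<integral>\<omega>. (\<Sum>m<L. indicat_real (?B m) \<omega>) \<partial>M)"
    by (subst Bochner_Integration.integral_sum) (auto simp: integrable_indicator_iff less_top[symmetric])
  also have "\<dots> \<le> (\<integral>\<omega>. real k \<partial>M)"
  proof (rule integral_mono)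
    fix \<omega>
    have "(\<Sum>m<L. indicat_real (?B m) \<omega>) = (\<Sum>m\<in>{m. m < L \<and> \<omega> \<in> ?B m}. 1)"
      by (rule sum.mono_neutral_cong_right) (auto simp: indicator_def)
    then show "(\<Sum>m<L. indicat_real (?B m) \<omega>) \<le> real k"
      using card[of \<omega>] by simp
  qed (auto simp: integrable_indicator_iff less_top[symmetric])
  also have "\<dots> = k" by (simp add: prob_space)
  finally show ?thesis .
qed

text \<open>Let \<open>\<rho>\<close> be the probability of staying outside the \<open>\<epsilon>\<close>-ball from time \<open>k\<close> on. The two preceding
lemmas, with \<open>\<epsilon> / 2\<close> for \<open>\<epsilon>\<close>, bound \<open>\<rho>\<close> times the expected number of visits to the ball of radius
\<open>\<epsilon> / 2\<close> by \<open>k\<close>. That number is infinite, so \<open>\<rho> = 0\<close>.\<close>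

lemma frequently_near_zero:
  assumes "persistent \<mu>" and "0 < \<epsilon>"
  shows "AE \<omega> in M. \<exists>\<^sub>F n in sequentially. norm (S n \<omega>) < \<epsilon>"
proof -
  define a where "a m = prob {\<omega> \<in> space M. norm (S m \<omega>) < \<epsilon> / 2}" for m
  have diverges: "\<not> summable a"
    using assms(1)[unfolded persistent_iff, rule_format, of "\<epsilon> / 2"] \<open>0 < \<epsilon>\<close>
    unfolding a_def[abs_def] by linarith
  have "AE \<omega> in M. \<exists>n\<ge>k. norm (S n \<omega>) < \<epsilon>" for k
  proof -
    define \<rho> where "\<rho> = prob {\<omega> \<in> space M. \<forall>n\<ge>k. \<epsilon> \<le> norm (S n \<omega>)}"
    have le: "(\<Sum>m<L. a m * \<rho>) \<le> k" for L
    proof -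
      have "(\<Sum>m<L. a m * \<rho>) \<le> (\<Sum>m<L. prob {\<omega> \<in> space M. norm (S m \<omega>) < \<epsilon> / 2 \<and> (\<forall>n\<ge>m + k. \<epsilon> / 2 \<le> norm (S n \<omega>))})"
        using prob_near_then_away[of _ "\<epsilon> / 2" k] by (intro sum_mono) (simp add: a_def \<rho>_def)
      also have "\<dots> \<le> k" by (rule sum_prob_last_visits_le)
      finally show ?thesis .
    qed
    have "summable (\<lambda>m. a m * \<rho>)"
      using le by (intro summableI_nonneg_bounded) (auto simp: a_def \<rho>_def)
    from summable_mult2[OF this, of "1 / \<rho>"] have "\<rho> = 0"
      using diverges by (cases "\<rho> = 0") simp_all
    moreover have "{\<omega> \<in> space M. \<forall>n\<ge>k. \<epsilon> \<le> norm (S n \<omega>)} \<in> sets M"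
      by measurable
    ultimately have "AE \<omega> in M. \<omega> \<notin> {\<omega> \<in> space M. \<forall>n\<ge>k. \<epsilon> \<le> norm (S n \<omega>)}"
      unfolding \<rho>_def by (simp add: prob_eq_0)
    then show ?thesis
      by (rule AE_mp) (auto simp: not_le)
  qed
  then have "AE \<omega> in M. \<forall>k. \<exists>n\<ge>k. norm (S n \<omega>) < \<epsilon>"
    by (simp add: AE_all_countable)
  then show ?thesis
    by (simp add: frequently_sequentially)
qed

text \<open>After the first entry into the ball around \<open>x\<close>, every visit to it is a return of the restarted walk
to within \<open>\<epsilon>\<close> of its starting point. Decomposing by the first entry time bounds the visit
probabilities by the Cauchy product of the (summable) first entry probabilities with the given
series.\<close>

lemma summable_visits_small_ball:
  assumes g: "summable (\<lambda>n. prob {\<omega> \<in> space M. norm (S n \<omega>) < \<epsilon>})"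
  shows "summable (\<lambda>n. prob {\<omega> \<in> space M. S n \<omega> \<in> ball x (\<epsilon> / 2)})"
proof (rule summable_comparison_test', rule summable_Cauchy_product)
  let ?T = "first_entry (ball x (\<epsilon> / 2)) 0"
  let ?g = "\<lambda>n. prob {\<omega> \<in> space M. norm (S n \<omega>) < \<epsilon>}"
  have disj: "disjoint_family ?T"
    using first_entry_disjoint[of "ball x (\<epsilon> / 2)" 0] by (simp add: atLeast_0)
  have "(\<lambda>j. prob (?T j)) sums prob (\<Union>j. ?T j)"
    using disj by (intro finite_measure_UNION) auto
  then show "summable (\<lambda>j. norm (prob (?T j)))"
    by (simp add: sums_iff)
  show "summable (\<lambda>n. norm (?g n))" using g by simp
  fix n
  let ?D = "\<lambda>j. {\<omega> \<in> space M. S n \<omega> - S j \<omega> \<in> ball 0 \<epsilon>}"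
  have "prob {\<omega> \<in> space M. S n \<omega> \<in> ball x (\<epsilon> / 2)} \<le> prob (\<Union>j\<in>{..n}. ?T j \<inter> ?D j)"
  proof (rule finite_measure_mono, intro subsetI)
    fix \<omega> assume \<omega>: "\<omega> \<in> {\<omega> \<in> space M. S n \<omega> \<in> ball x (\<epsilon> / 2)}"
    then have "\<omega> \<in> {\<omega> \<in> space M. \<exists>j\<in>{0..n}. S j \<omega> \<in> ball x (\<epsilon> / 2)}"
      by auto
    then obtain j where j: "j \<le> n" "\<omega> \<in> ?T j"
      unfolding visit_eq_UN_first_entry by auto
    then have "dist (S n \<omega>) (S j \<omega>) < \<epsilon>"
      using \<omega> by (auto simp: first_entry_def dist_commute intro: dist_triangle_half_r)
    then have "\<omega> \<in> ?D j"
      using \<omega> by (simp add: dist_norm norm_minus_commute)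
    with j show "\<omega> \<in> (\<Union>j\<in>{..n}. ?T j \<inter> ?D j)"
      by blast
  qed (intro sets.finite_UN; auto)
  also have "\<dots> \<le> (\<Sum>j\<le>n. prob (?T j \<inter> ?D j))"
    by (rule finite_measure_subadditive_finite) auto
  also have "\<dots> = (\<Sum>j\<le>n. prob (?T j) * ?g (n - j))"
    by (intro sum.cong refl, subst prob_first_entry_and_increment)
      (simp_all add: prob_norm_increment)
  finally show "norm (prob {\<omega> \<in> space M. S n \<omega> \<in> ball x (\<epsilon> / 2)}) \<le> (\<Sum>j\<le>n. prob (?T j) * ?g (n - j))"
    by simp
qed

text \<open>A ball is covered by finitely many balls of radius \<open>\<epsilon> / 2\<close>, and the preceding lemma applies to each
of these, whatever its centre.\<close>

lemma summable_visits_any_ball: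
  assumes "0 < \<epsilon>" and g: "summable (\<lambda>n. prob {\<omega> \<in> space M. norm (S n \<omega>) < \<epsilon>})"
  shows "summable (\<lambda>n. prob {\<omega> \<in> space M. norm (S n \<omega>) < r})"
proof -
  obtain F :: "'a set" where F: "finite F" "cball 0 r \<subseteq> (\<Union>x\<in>F. ball x (\<epsilon> / 2))"
    using compact_imp_seq_compact[OF compact_cball, THEN seq_compact_imp_totally_bounded,
      of "0::'a" r] \<open>0 < \<epsilon>\<close> half_gt_zero by meson
  show ?thesis
  proof (rule summable_comparison_test')
    show "summable (\<lambda>n. \<Sum>x\<in>F. prob {\<omega> \<in> space M. S n \<omega> \<in> ball x (\<epsilon> / 2)})"
      using summable_visits_small_ball[OF g] by (intro summable_sum)
    fix n
    have "prob {\<omega> \<in> space M. norm (S n \<omega>) < r} \<le> prob (\<Union>x\<in>F. {\<omega> \<in> space M. S n \<omega> \<in> ball x (\<epsilon> / 2)})"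
      using F by (intro finite_measure_mono) (auto simp: subset_eq dest: less_imp_le)
    also have "\<dots> \<le> (\<Sum>x\<in>F. prob {\<omega> \<in> space M. S n \<omega> \<in> ball x (\<epsilon> / 2)})"
      using F(1) by (intro finite_measure_subadditive_finite) auto
    finally show "norm (prob {\<omega> \<in> space M. norm (S n \<omega>) < r})
        \<le> (\<Sum>x\<in>F. prob {\<omega> \<in> space M. S n \<omega> \<in> ball x (\<epsilon> / 2)})"
      by simp
  qed
qed

end

section \<open>Additive processes on time grids\<close>

context additive_process begin

lemma measurable_process [measurable (raw)]: "0 \<le> t \<Longrightarrow> X t \<in> borel_measurable M"
  by (rule random_variable_process)

definition grid_step :: "real \<Rightarrow> real \<Rightarrow> nat \<Rightarrow> 'w \<Rightarrow> 'a" where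
  "grid_step s h i \<omega> = X (s + real (Suc i) * h) \<omega> - X (s + real i * h) \<omega>"

lemma grid_steps:
  assumes "0 \<le> s" "0 < h"
  shows "independent_steps M (grid_step s h)"
proof unfold_locales
  have "indep_vars (\<lambda>_. borel) (grid_step s h) {..<n}" for n
    using independent_increments[of "\<lambda>i. s + real i * h" n] assms
    by (simp add: grid_step_def[abs_def])
  then show "indep_vars (\<lambda>_. borel) (grid_step s h) UNIV"
    by (rule indep_vars_UNIV_if_initial)
qed

lemma S_grid_steps:
  assumes "0 \<le> s" "0 < h"
  shows "independent_steps.S (grid_step s h) n \<omega> = X (s + real n * h) \<omega> - X s \<omega>"
  unfolding independent_steps.S_def[OF grid_steps[OF assms]]
  using sum_lessThan_telescope[of "\<lambda>i. X (s + real i * h) \<omega>" n]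
  by (simp add: grid_step_def)

lemma indep_consecutive_increments:
  assumes "0 \<le> t0" "t0 < t1" "t1 < t2"
  shows "indep_var borel (\<lambda>\<omega>. X t1 \<omega> - X t0 \<omega>) borel (\<lambda>\<omega>. X t2 \<omega> - X t1 \<omega>)"
proof -
  let ?t = "\<lambda>i::nat. if i = 0 then t0 else if i = 1 then t1 else t2"
  have "indep_vars (\<lambda>_. borel) (\<lambda>i \<omega>. X (?t (Suc i)) \<omega> - X (?t i) \<omega>) {..<2}"
    using assms by (intro independent_increments) auto
  then have "indep_var (PiM {0} (\<lambda>_. borel)) (\<lambda>\<omega>. \<lambda>i\<in>{0}. X (?t (Suc i)) \<omega> - X (?t i) \<omega>)
      (PiM {1} (\<lambda>_. borel)) (\<lambda>\<omega>. \<lambda>i\<in>{1}. X (?t (Suc i)) \<omega> - X (?t i) \<omega>)"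
    by (rule indep_var_restrict) auto
  moreover have "(\<lambda>x. x 0) \<in> borel_measurable (PiM {0::nat} (\<lambda>_. borel :: 'a measure))"
    "(\<lambda>x. x 1) \<in> borel_measurable (PiM {1::nat} (\<lambda>_. borel :: 'a measure))"
    by measurable
  ultimately have "indep_var borel ((\<lambda>x. x 0) \<circ> (\<lambda>\<omega>. \<lambda>i\<in>{0}. X (?t (Suc i)) \<omega> - X (?t i) \<omega>))
      borel ((\<lambda>x. x 1) \<circ> (\<lambda>\<omega>. \<lambda>i\<in>{1}. X (?t (Suc i)) \<omega> - X (?t i) \<omega>))"
    by (rule indep_var_compose)
  then show ?thesis
    by (simp add: comp_def)
qed

text \<open>Each single increment \<open>X T - X u\<close> is tight, by stochastic continuity the same radius, enlarged by
\<open>1\<close>, serves all times close to \<open>u\<close>, and finitely many such neighbourhoods cover \<open>{0..T}\<close>.\<close>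

lemma increments_uniformly_tight:
  assumes "0 \<le> T"
  shows "\<exists>K. \<forall>u\<in>{0..T}. 1 / 2 \<le> prob {\<omega> \<in> space M. norm (X T \<omega> - X u \<omega>) \<le> K}"
proof -
  have "\<exists>K U. open U \<and> u \<in> U \<and> (\<forall>v\<in>U \<inter> {0..T}. prob {\<omega> \<in> space M. norm (X T \<omega> - X v \<omega>) > K} < 1 / 2)"
    if u: "u \<in> {0..T}" for u
  proof -
    have [measurable]: "X T \<in> borel_measurable M" "X u \<in> borel_measurable M"
      using assms u by auto
    obtain K where K: "prob {\<omega> \<in> space M. norm (X T \<omega> - X u \<omega>) > K} < 1 / 4"
      using norm_tail_small[of "\<lambda>\<omega>. X T \<omega> - X u \<omega>" "1 / 4"] by auto
    have "\<forall>\<^sub>F v in at u within {0..}. prob {\<omega> \<in> space M. norm (X v \<omega> - X u \<omega>) > 1} < 1 / 4"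
      using u by (intro order_tendstoD(2)[OF stochastically_continuous]) auto
    then obtain U where U: "open U" "u \<in> U"
      and near: "\<And>v. v \<in> U \<Longrightarrow> v \<noteq> u \<Longrightarrow> 0 \<le> v \<Longrightarrow> prob {\<omega> \<in> space M. norm (X v \<omega> - X u \<omega>) > 1} < 1 / 4"
      unfolding eventually_at_topological by auto
    have "prob {\<omega> \<in> space M. norm (X T \<omega> - X v \<omega>) > K + 1} < 1 / 2" if v: "v \<in> U" "0 \<le> v" for v
    proof -
      have [measurable]: "X v \<in> borel_measurable M" using v by auto
      have "prob {\<omega> \<in> space M. norm (X T \<omega> - X v \<omega>) > K + 1}
        \<le> prob ({\<omega> \<in> space M. norm (X T \<omega> - X u \<omega>) > K} \<union> {\<omega> \<in> space M. norm (X v \<omega> - X u \<omega>) > 1})"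
      proof (rule finite_measure_mono)
        have "norm (X T \<omega> - X u \<omega>) > K \<or> norm (X v \<omega> - X u \<omega>) > 1" if "norm (X T \<omega> - X v \<omega>) > K + 1" for \<omega>
          using norm_triangle_ineq4[of "X T \<omega> - X u \<omega>" "X v \<omega> - X u \<omega>"] that by auto
        then show "{\<omega> \<in> space M. norm (X T \<omega> - X v \<omega>) > K + 1}
          \<subseteq> {\<omega> \<in> space M. norm (X T \<omega> - X u \<omega>) > K} \<union> {\<omega> \<in> space M. norm (X v \<omega> - X u \<omega>) > 1}"
          by auto
      qed measurable
      also have "\<dots> \<le> prob {\<omega> \<in> space M. norm (X T \<omega> - X u \<omega>) > K} + prob {\<omega> \<in> space M. norm (X v \<omega> - X u \<omega>) > 1}"
        by (rule measure_Un_le) measurable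
      also have "prob {\<omega> \<in> space M. norm (X v \<omega> - X u \<omega>) > 1} < 1 / 4"
        using near[of v] v by (cases "v = u") auto
      finally show ?thesis using K by simp
    qed
    with U show ?thesis by (intro exI[of _ "K + 1"] exI[of _ U]) auto
  qed
  then obtain K U where KU: "\<And>u. u \<in> {0..T} \<Longrightarrow> open (U u) \<and> u \<in> U u \<and>
      (\<forall>v\<in>U u \<inter> {0..T}. prob {\<omega> \<in> space M. norm (X T \<omega> - X v \<omega>) > K u} < 1 / 2)"
    by metis
  obtain C where C: "C \<subseteq> {0..T}" "finite C" "{0..T} \<subseteq> (\<Union>u\<in>C. U u)"
    by (rule compactE_image[of "{0..T}" "{0..T}" U]) (use KU in auto)
  show ?thesis
  proof (intro exI ballI)
    fix v assume v: "v \<in> {0..T}"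
    then obtain u where u: "u \<in> C" "v \<in> U u" using C(3) by auto
    have [measurable]: "X T \<in> borel_measurable M" "X v \<in> borel_measurable M"
      using assms v by auto
    have "prob {\<omega> \<in> space M. norm (X T \<omega> - X v \<omega>) > K u} < 1 / 2"
      using KU[of u] u v C(1) by auto
    then have "1 / 2 \<le> prob {\<omega> \<in> space M. norm (X T \<omega> - X v \<omega>) \<le> K u}"
      using prob_neg[of "\<lambda>\<omega>. norm (X T \<omega> - X v \<omega>) \<le> K u"] by (simp add: not_le)
    also have "\<dots> \<le> prob {\<omega> \<in> space M. norm (X T \<omega> - X v \<omega>) \<le> Max (K ` C)}"
      using u C(2) by (intro finite_measure_mono) (auto intro: order_trans Max_ge)
    finally show "1 / 2 \<le> prob {\<omega> \<in> space M. norm (X T \<omega> - X v \<omega>) \<le> Max (K ` C)}" .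
  qed
qed

end

lemma Liminf_eq_0_iff_frequently_small:
  fixes f :: "real \<Rightarrow> real"
  assumes nonneg: "\<And>t. 0 \<le> f t"
  shows "Liminf at_top (\<lambda>t. ereal (f t)) = 0 \<longleftrightarrow> (\<forall>\<epsilon>>0. \<exists>\<^sub>F t in at_top. f t < \<epsilon>)"
proof
  assume L: "Liminf at_top (\<lambda>t. ereal (f t)) = 0"
  show "\<forall>\<epsilon>>0. \<exists>\<^sub>F t in at_top. f t < \<epsilon>"
  proof (intro allI impI, rule ccontr)
    fix \<epsilon> :: real assume "0 < \<epsilon>" "\<not> (\<exists>\<^sub>F t in at_top. f t < \<epsilon>)"
    then have "\<forall>\<^sub>F t in at_top. ereal \<epsilon> \<le> ereal (f t)"
      by (simp add: not_frequently not_less)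
    from Liminf_bounded[OF this] L \<open>0 < \<epsilon>\<close> show False by simp
  qed
next
  assume small: "\<forall>\<epsilon>>0. \<exists>\<^sub>F t in at_top. f t < \<epsilon>"
  show "Liminf at_top (\<lambda>t. ereal (f t)) = 0"
  proof (rule antisym)
    show "0 \<le> Liminf at_top (\<lambda>t. ereal (f t))"
      using nonneg by (intro Liminf_bounded) (simp add: zero_ereal_def)
    show "Liminf at_top (\<lambda>t. ereal (f t)) \<le> 0"
    proof (rule ccontr)
      assume "\<not> Liminf at_top (\<lambda>t. ereal (f t)) \<le> 0"
      then obtain \<epsilon> where "0 < ereal \<epsilon>" "ereal \<epsilon> < Liminf at_top (\<lambda>t. ereal (f t))"
        using ereal_dense2[of 0 "Liminf at_top (\<lambda>t. ereal (f t))"] by (auto simp: not_le)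
      have "\<forall>\<^sub>F t in at_top. \<not> f t < \<epsilon>"
        using less_LiminfD[OF \<open>ereal \<epsilon> < _\<close>] by (rule eventually_mono) simp
      with small \<open>0 < ereal \<epsilon>\<close> show False
        by (auto simp: frequently_def)
    qed
  qed
qed

section \<open>Recurrence of semi-Levy processes\<close>

context semi_levy_process begin

lemma shift_increment_by_periods:
  assumes "0 \<le> s" "0 \<le> t"
  shows "distr M borel (\<lambda>\<omega>. X (t + real n * p) \<omega> - X (s + real n * p) \<omega>) = distr M borel (\<lambda>\<omega>. X t \<omega> - X s \<omega>)"
proof (induction n)
  case (Suc n)
  have "0 \<le> s + real n * p" "0 \<le> t + real n * p" using assms period_pos by auto
  from periodic_increments[OF this] Suc show ?case
    by (simp add: algebra_simps)
qed simp

text \<open>Write \<open>s = r + n * p\<close> with \<open>0 \<le> r < p\<close>. By periodicity \<open>s\<close> may be replaced by \<open>r\<close>. The increments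
over \<open>{0..p}\<close> and \<open>{r..r + p}\<close> are then both sums of two independent parts with the same two laws,
in opposite order.\<close>

lemma increment_over_period:
  assumes "0 \<le> s"
  shows "distr M borel (\<lambda>\<omega>. X (s + p) \<omega> - X s \<omega>) = distr M borel (X p)"
proof -
  have [measurable]: "X 0 \<in> borel_measurable M" "X p \<in> borel_measurable M"
    using period_pos by auto
  have zero: "distr M borel (\<lambda>\<omega>. X p \<omega> - X 0 \<omega>) = distr M borel (X p)"
    using start_at_zero by (intro distr_cong_AE) auto
  have within: "distr M borel (\<lambda>\<omega>. X (r + p) \<omega> - X r \<omega>) = distr M borel (X p)" if r: "0 \<le> r" "r < p" for r
  proof (cases "r = 0")
    case False
    have "distr M borel (\<lambda>\<omega>. (X r \<omega> - X 0 \<omega>) + (X p \<omega> - X r \<omega>))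
      = distr M borel (\<lambda>\<omega>. (X p \<omega> - X r \<omega>) + (X (r + p) \<omega> - X p \<omega>))"
    proof (rule distr_add_cong_swap)
      show "indep_var borel (\<lambda>\<omega>. X r \<omega> - X 0 \<omega>) borel (\<lambda>\<omega>. X p \<omega> - X r \<omega>)"
        "indep_var borel (\<lambda>\<omega>. X p \<omega> - X r \<omega>) borel (\<lambda>\<omega>. X (r + p) \<omega> - X p \<omega>)"
        using r False by (auto intro!: indep_consecutive_increments)
      show "distr M borel (\<lambda>\<omega>. X r \<omega> - X 0 \<omega>) = distr M borel (\<lambda>\<omega>. X (r + p) \<omega> - X p \<omega>)"
        using periodic_increments[of 0 r] r by simp
    qed simp
    then show ?thesis using zero by simp
  qed (use zero in simp)
  define n where "n = nat \<lfloor>s / p\<rfloor>"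
  define r where "r = s - real n * p"
  have n: "real n = of_int \<lfloor>s / p\<rfloor>"
    using assms period_pos by (simp add: n_def)
  have "real n * p \<le> s" "s < (real n + 1) * p"
    using floor_divide_lower[OF period_pos, of s] floor_divide_upper[OF period_pos, of s] n
    by simp_all
  then have r: "0 \<le> r" "r < p" by (simp_all add: r_def algebra_simps)
  have s: "s = r + real n * p" by (simp add: r_def)
  have "distr M borel (\<lambda>\<omega>. X (s + p) \<omega> - X s \<omega>) = distr M borel (\<lambda>\<omega>. X (r + p) \<omega> - X r \<omega>)"
    using shift_increment_by_periods[of r "r + p" n] r period_pos by (simp add: s algebra_simps)
  with within r show ?thesis by simp
qed

lemma period_walk:
  assumes "0 \<le> s"
  shows "random_walk M (grid_step s p) (distr M borel (X p))"
proof -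
  interpret independent_steps M "grid_step s p"
    by (rule grid_steps[OF assms period_pos])
  show ?thesis
  proof
    fix i :: nat
    show "distr M borel (grid_step s p i) = distr M borel (X p)"
      using increment_over_period[of "s + real i * p"] assms period_pos
      by (simp add: grid_step_def[abs_def] algebra_simps)
  qed
qed

lemma recurrent_if_persistent:
  assumes pers: "persistent (distr M borel (X p))"
  shows "recurrent M X"
  unfolding recurrent_def
proof (intro allI impI)
  fix s :: real assume s: "0 \<le> s"
  interpret W: random_walk M "grid_step s p" "distr M borel (X p)"
    by (rule period_walk[OF s])
  have "AE \<omega> in M. \<exists>\<^sub>F n in sequentially. norm (X (s + real n * p) \<omega> - X s \<omega>) < 1 / Suc k" for k
    using W.frequently_near_zero[OF pers, of "1 / Suc k"]
    by (simp add: S_grid_steps[OF s period_pos])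
  then have "AE \<omega> in M. \<forall>k. \<exists>\<^sub>F n in sequentially. norm (X (s + real n * p) \<omega> - X s \<omega>) < 1 / Suc k"
    by (simp add: AE_all_countable)
  then show "AE \<omega> in M. Liminf at_top (\<lambda>t. ereal (norm (X t \<omega> - X s \<omega>))) = 0"
  proof (rule AE_mp, intro AE_I2 impI)
    fix \<omega> assume near: "\<forall>k. \<exists>\<^sub>F n in sequentially. norm (X (s + real n * p) \<omega> - X s \<omega>) < 1 / Suc k"
    have lim: "filterlim (\<lambda>n. s + real n * p) at_top sequentially"
      using period_pos
      by (intro filterlim_tendsto_add_at_top[OF tendsto_const]
          filterlim_at_top_mult_tendsto_pos[OF tendsto_const] filterlim_real_sequentially)
    have "\<exists>\<^sub>F t in at_top. norm (X t \<omega> - X s \<omega>) < \<epsilon>" if "0 < \<epsilon>" for \<epsilon>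
    proof -
      obtain k where "1 / Suc k < \<epsilon>"
        by (rule nat_approx_posE[OF \<open>0 < \<epsilon>\<close>])
      then have "\<exists>\<^sub>F n in sequentially. norm (X (s + real n * p) \<omega> - X s \<omega>) < \<epsilon>"
        using near[rule_format, of k] by (auto elim!: frequently_elim1)
      then show ?thesis
        using eventually_compose_filterlim[OF _ lim, of "\<lambda>t. \<not> norm (X t \<omega> - X s \<omega>) < \<epsilon>"]
        unfolding frequently_def by blast
    qed
    then show "Liminf at_top (\<lambda>t. ereal (norm (X t \<omega> - X s \<omega>))) = 0"
      by (subst Liminf_eq_0_iff_frequently_small) auto
  qed
qed

text \<open>The interval \<open>{n * p..(n + 1) * p}\<close> is inspected at multiples of \<open>p / 2 ^ q\<close>; powers of \<open>2\<close> make
the grids nested. Both endpoints are included, as the walk on the grid is followed up to time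
\<open>(n + 1) * p\<close>.\<close>

definition grid_visit :: "nat \<Rightarrow> nat \<Rightarrow> 'w set" where
  "grid_visit n q = {\<omega> \<in> space M. \<exists>j\<in>{n * 2 ^ q..(n + 1) * 2 ^ q}. norm (X (real j * (p / 2 ^ q)) \<omega> - X 0 \<omega>) < 1}"

lemma sets_grid_visit [measurable]: "grid_visit n q \<in> sets M"
proof -
  have [measurable]: "X (real j * (p / 2 ^ q)) \<in> borel_measurable M" "X 0 \<in> borel_measurable M" for j :: nat
    using period_pos by auto
  show ?thesis unfolding grid_visit_def by measurable
qed

lemma incseq_grid_visit: "incseq (grid_visit n)"
proof (intro incseq_SucI subsetI)
  fix q \<omega> assume "\<omega> \<in> grid_visit n q"
  then obtain j where j: "\<omega> \<in> space M" "j \<in> {n * 2 ^ q..(n + 1) * 2 ^ q}"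
      "norm (X (real j * (p / 2 ^ q)) \<omega> - X 0 \<omega>) < 1"
    unfolding grid_visit_def by auto
  have "real (2 * j) * (p / 2 ^ Suc q) = real j * (p / 2 ^ q)"
    by simp
  moreover have "2 * j \<in> {n * 2 ^ Suc q..(n + 1) * 2 ^ Suc q}"
    using j(2) by auto
  ultimately show "\<omega> \<in> grid_visit n (Suc q)"
    unfolding grid_visit_def using j(1,3) by (metis (mono_tags, lifting) mem_Collect_eq)
qed

text \<open>By right-continuity a visit to the open unit ball at time \<open>t\<close> lasts for some time after \<open>t\<close>, hence
is seen on every sufficiently fine grid.\<close>

lemma visit_imp_grid_visit:
  assumes \<omega>: "\<omega> \<in> space M" and t: "real n * p \<le> t" "t < (real n + 1) * p"
    and small: "norm (X t \<omega> - X 0 \<omega>) < 1"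
  shows "\<exists>q. \<omega> \<in> grid_visit n q"
proof -
  have t0: "0 \<le> t" using t(1) period_pos by (meson order_trans mult_nonneg_nonneg of_nat_0_le_iff less_imp_le)
  have "((\<lambda>u. norm (X u \<omega> - X 0 \<omega>)) \<longlongrightarrow> norm (X t \<omega> - X 0 \<omega>)) (at_right t)"
    using right_continuous_paths[OF \<omega> t0] unfolding continuous_within by (intro tendsto_intros)
  from order_tendstoD(2)[OF this small]
  obtain b where b: "t < b" "\<And>u. t < u \<Longrightarrow> u < b \<Longrightarrow> norm (X u \<omega> - X 0 \<omega>) < 1"
    unfolding eventually_at_right_field by auto
  \<comment> \<open>The grid point must lie both in the right neighbourhood \<open>{t..<b}\<close> and in the same period
    as \<open>t\<close>.\<close>
  define \<delta> where "\<delta> = min (b - t) ((real n + 1) * p - t)"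
  have "0 < \<delta>" using b t by (simp add: \<delta>_def)
  then obtain q where "(1 / 2) ^ q < \<delta> / p"
    using period_pos real_arch_pow_inv[of "\<delta> / p" "1 / 2"] by auto
  then have q: "p / 2 ^ q < \<delta>"
    using period_pos by (simp add: field_simps power_one_over)
  define h where "h = p / 2 ^ q"
  have h: "0 < h" "h < \<delta>" "p = 2 ^ q * h"
    using q period_pos by (simp_all add: h_def)
  define j where "j = nat \<lceil>t / h\<rceil>"
  have j: "real j = of_int \<lceil>t / h\<rceil>" using t0 h by (simp add: j_def)
  have jt: "t \<le> real j * h" "real j * h < t + h"
    using ceiling_correct[of "t / h"] h unfolding j[symmetric] by (simp_all add: field_simps)
  have "real (n * 2 ^ q) * h \<le> real j * h"
    using jt(1) t(1) h(3) by (simp add: algebra_simps)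
  then have lower: "n * 2 ^ q \<le> j"
    using h(1) by (simp only: mult_le_cancel_right_pos of_nat_le_iff)
  have "real j * h < real ((n + 1) * 2 ^ q) * h"
    using jt(2) h(2,3) by (simp add: \<delta>_def algebra_simps)
  then have upper: "j < (n + 1) * 2 ^ q"
    using h(1) by (simp only: mult_less_cancel_right_pos of_nat_less_iff)
  have "norm (X (real j * h) \<omega> - X 0 \<omega>) < 1"
    using b(2)[of "real j * h"] jt h(2) small by (cases "real j * h = t") (auto simp: \<delta>_def)
  then show ?thesis
    using \<omega> lower upper unfolding grid_visit_def h_def by (auto intro!: exI[of _ q] bexI[of _ j])
qed

text \<open>By contraposition. If the walk at the times \<open>n * p\<close> is not persistent, then the probabilities of
visiting the unit ball during the \<open>n\<close>-th period are summable, so that almost surely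
\<open>|X t - X 0| \<ge> 1\<close> for all large \<open>t\<close>.\<close>

lemma persistent_if_recurrent:
  assumes rec: "recurrent M X"
  shows "persistent (distr M borel (X p))"
proof -
  interpret W: random_walk M "grid_step 0 p" "distr M borel (X p)"
    by (rule period_walk) simp
  have W_S: "W.S n \<omega> = X (real n * p) \<omega> - X 0 \<omega>" for n \<omega>
    using S_grid_steps[of 0 p n \<omega>] period_pos by simp
  show ?thesis
  proof (rule ccontr)
    assume "\<not> persistent (distr M borel (X p))"
    then obtain \<epsilon> where "0 < \<epsilon>" "summable (\<lambda>n. prob {\<omega> \<in> space M. norm (W.S n \<omega>) < \<epsilon>})"
      unfolding W.persistent_iff by auto
    then have transient: "summable (\<lambda>n. prob {\<omega> \<in> space M. norm (X (real n * p) \<omega> - X 0 \<omega>) < r})" for r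
      using W.summable_visits_any_ball[of \<epsilon> r] unfolding W_S by blast
    obtain K where K: "\<forall>u\<in>{0..p}. 1 / 2 \<le> prob {\<omega> \<in> space M. norm (X p \<omega> - X u \<omega>) \<le> K}"
      using increments_uniformly_tight[OF less_imp_le[OF period_pos]] by blast
    \<comment> \<open>Periodicity carries the bound from the first period to all of them, with the same \<open>K\<close>.\<close>
    have tight: "1 / 2 \<le> prob {\<omega> \<in> space M. norm (X ((real n + 1) * p) \<omega> - X v \<omega>) \<le> K}"
      if v: "real n * p \<le> v" "v \<le> (real n + 1) * p" for n :: nat and v
    proof -
      define u where "u = v - real n * p"
      have u: "0 \<le> u" "u \<le> p" "v = u + real n * p" using v by (simp_all add: u_def algebra_simps)
      have [measurable]: "X p \<in> borel_measurable M" "X u \<in> borel_measurable M"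
        "X (p + real n * p) \<in> borel_measurable M" "X (u + real n * p) \<in> borel_measurable M"
        using u period_pos by auto
      have "measure (distr M borel (\<lambda>\<omega>. X (p + real n * p) \<omega> - X (u + real n * p) \<omega>)) (cball 0 K)
        = measure (distr M borel (\<lambda>\<omega>. X p \<omega> - X u \<omega>)) (cball 0 K)"
        using shift_increment_by_periods[of u p n] u period_pos by simp
      then have "prob {\<omega> \<in> space M. norm (X (p + real n * p) \<omega> - X (u + real n * p) \<omega>) \<le> K}
        = prob {\<omega> \<in> space M. norm (X p \<omega> - X u \<omega>) \<le> K}"
        by (simp add: measure_distr vimage_def Int_def conj_commute)
      with K[rule_format, of u] u show ?thesis by (simp add: algebra_simps)
    qed
    have grid_le: "prob (grid_visit n q) \<le> 2 * prob {\<omega> \<in> space M. norm (X ((real n + 1) * p) \<omega> - X 0 \<omega>) < 1 + K}" for n q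
    proof -
      define h where "h = p / 2 ^ q"
      have h: "0 < h" "p = 2 ^ q * h" using period_pos by (simp_all add: h_def)
      interpret G: independent_steps M "grid_step 0 h"
        by (rule grid_steps) (use h in auto)
      have G_S: "G.S j \<omega> = X (real j * h) \<omega> - X 0 \<omega>" for j \<omega>
        using S_grid_steps[of 0 h j \<omega>] h by simp
      let ?m = "(n + 1) * 2 ^ q"
      have m: "real ?m * h = (real n + 1) * p" by (simp add: h(2) algebra_simps)
      \<comment> \<open>The Ottaviani inequality for the walk on the grid, started at time \<open>0\<close> but watched only during
        the period in question.\<close>
      have "1 / 2 * prob {\<omega> \<in> space M. \<exists>j\<in>{n * 2 ^ q..?m}. norm (G.S j \<omega>) < 1}
        \<le> prob {\<omega> \<in> space M. norm (G.S ?m \<omega>) < 1 + K}"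
      proof (rule G.prob_visit_ball_le)
        fix j assume j: "n * 2 ^ q \<le> j" "j \<le> ?m"
        have "real (n * 2 ^ q) * h \<le> real j * h" "real j * h \<le> real ?m * h"
          using j h(1) by (intro mult_right_mono; simp only: of_nat_le_iff less_imp_le)+
        then have "real n * p \<le> real j * h" "real j * h \<le> (real n + 1) * p"
          using m h(2) by (simp_all add: algebra_simps)
        from tight[OF this] show "1 / 2 \<le> prob {\<omega> \<in> space M. norm (G.S ?m \<omega> - G.S j \<omega>) \<le> K}"
          unfolding G_S m by simp
      qed
      then show ?thesis
        unfolding G_S m grid_visit_def h_def[symmetric] by simp
    qed
    define F where "F n = (\<Union>q. grid_visit n q)" for n
    have [measurable]: "F n \<in> sets M" for n unfolding F_def by measurable
    \<comment> \<open>The bound does not depend on the mesh of the grid, so it passes to the increasing limit.\<close>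
    have F_le: "prob (F n) \<le> 2 * prob {\<omega> \<in> space M. norm (X (real (Suc n) * p) \<omega> - X 0 \<omega>) < 1 + K}" for n
    proof (rule LIMSEQ_le_const2)
      show "(\<lambda>q. prob (grid_visit n q)) \<longlonglongrightarrow> prob (F n)"
        unfolding F_def using incseq_grid_visit by (intro finite_Lim_measure_incseq) auto
      show "\<exists>N. \<forall>q\<ge>N. prob (grid_visit n q) \<le> 2 * prob {\<omega> \<in> space M. norm (X (real (Suc n) * p) \<omega> - X 0 \<omega>) < 1 + K}"
        using grid_le[of n] by (simp add: add.commute)
    qed
    have "summable (\<lambda>n. prob (F n))"
    proof (rule summable_comparison_test')
      show "summable (\<lambda>n. 2 * prob {\<omega> \<in> space M. norm (X (real (Suc n) * p) \<omega> - X 0 \<omega>) < 1 + K})"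
        using transient[of "1 + K"] summable_Suc_iff[of "\<lambda>n. prob {\<omega> \<in> space M. norm (X (real n * p) \<omega> - X 0 \<omega>) < 1 + K}"]
        by (intro summable_mult) simp
    qed (use F_le in simp)
    then have "AE \<omega> in M. \<forall>\<^sub>F n in sequentially. \<omega> \<in> space M - F n"
      by (intro borel_cantelli_AE1) (auto simp: less_top[symmetric])
    moreover have "AE \<omega> in M. Liminf at_top (\<lambda>t. ereal (norm (X t \<omega> - X 0 \<omega>))) = 0"
      using rec by (simp add: recurrent_def)
    ultimately have "AE \<omega> in M. False"
    proof eventually_elim
      case (elim \<omega>)
      then obtain n0 where n0: "\<And>n. n \<ge> n0 \<Longrightarrow> \<omega> \<in> space M - F n"
        by (auto simp: eventually_sequentially)
      have "\<exists>\<^sub>F t in at_top. norm (X t \<omega> - X 0 \<omega>) < 1"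
        using elim(2) by (subst (asm) Liminf_eq_0_iff_frequently_small) auto
      from frequently_ex[OF frequently_eventually_frequently[OF this eventually_ge_at_top[of "real n0 * p"]]]
      obtain t where t: "t \<ge> real n0 * p" "norm (X t \<omega> - X 0 \<omega>) < 1"
        by blast
      define n where "n = nat \<lfloor>t / p\<rfloor>"
      have "0 \<le> t" using t(1) period_pos by (meson order_trans mult_nonneg_nonneg of_nat_0_le_iff less_imp_le)
      then have n: "real n = of_int \<lfloor>t / p\<rfloor>" using period_pos by (simp add: n_def)
      have nt: "real n * p \<le> t" "t < (real n + 1) * p"
        using floor_divide_lower[OF period_pos, of t] floor_divide_upper[OF period_pos, of t] n
        by simp_all
      have "real n0 \<le> t / p" using t(1) period_pos by (simp add: field_simps)
      then have "n0 \<le> n" unfolding n_def by (simp add: le_nat_iff le_floor_iff)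
      then have "\<omega> \<in> space M" "\<omega> \<notin> F n" using n0 by auto
      with visit_imp_grid_visit[of \<omega> n t] nt t(2) show False by (auto simp: F_def)
    qed
    then show False by simp
  qed
qed

theorem recurrent_iff_persistent: "recurrent M X \<longleftrightarrow> persistent (distr M borel (X p))"
  using recurrent_if_persistent persistent_if_recurrent by blast

end

lemma (in levy_process) semi_levy_process:
  assumes "0 < p"
  shows "semi_levy_process M X p"
  by unfold_locales (use assms stationary_increments in auto)

theorem theorem1p5:
  fixes M :: "'w measure" and N :: "'v measure"
    and X :: "real \<Rightarrow> 'w \<Rightarrow> 'a::euclidean_space"
    and Y :: "real \<Rightarrow> 'v \<Rightarrow> 'a"
    and p :: real
  assumes "p > 0"
    and "semi_levy_process M X p"
    and "levy_process N Y"
    and "distr N borel (Y 1) = distr M borel (X p)"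
  shows "recurrent M X \<longleftrightarrow> recurrent N Y"
proof -
  have "recurrent M X \<longleftrightarrow> persistent (distr M borel (X p))"
    by (rule semi_levy_process.recurrent_iff_persistent) fact
  moreover have "recurrent N Y \<longleftrightarrow> persistent (distr N borel (Y 1))"
    by (intro semi_levy_process.recurrent_iff_persistent levy_process.semi_levy_process assms) simp
  ultimately show ?thesis
    using assms(4) by simp
qed

end
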